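(* Let $\mathcal{U},\mathcal{V}$ be linear subspaces of $\mathbb{R}^n$ with $\dim(\mathcal{U}\cap\mathcal{V})<\min(\dim\mathcal{U},\dim\mathcal{V})$, so that their Friedrichs angle $\theta_F\in(0,\pi/2]$ is defined. Let $$S=(1-\alpha)I+\alpha P_{\mathcal{U}}^{\alpha_2}P_{\mathcal{V}}^{\alpha_1},\qquad \alpha=1,\quad \alpha_1=\alpha_2=\frac{2}{1+\sin\theta_F},\qquad \gamma^*:=\frac{1-\sin\theta_F}{1+\sin\theta_F}.$$ Let $x^0\in\mathbb{R}^n$ and $x^{k+1}:=Sx^k$ for $k\ge0$. Then $x^k$ converges linearly to $x^*:=P_{\mathrm{fix}\,S}\,x^0$ with any rate $\mu\in(\gamma^*,1)$: for every $\mu\in(\gamma^*,1)$ there exists $N\in\mathbb{N}$ such that $$\|x^k-x^*\|\le\mu^k\|x^0\|\qquad\text{for all }k\ge N .$$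
   Context: $P_{\mathcal{C}}$ denotes the orthogonal projection onto $\mathcal{C}$, and $P_{\mathcal{C}}^{\alpha}:=(1-\alpha)I+\alpha P_{\mathcal{C}}$ is the relaxed projection with relaxation parameter $\alpha$. $\mathrm{fix}\,S=\{x: Sx=x\}$. Principal angles: for subspaces $\mathcal{U},\mathcal{V}\subseteq\mathbb{R}^n$ and $m=\min(\dim\mathcal{U},\dim\mathcal{V})$, the principal angles $\theta_k\in[0,\pi/2]$, $k=1,\dots,m$, are defined recursively by $\cos\theta_k:=\max\langle u_k,v_k\rangle$ over $u_k\in\mathcal{U}$, $v_k\in\mathcal{V}$ with $\|u_k\|=\|v_k\|=1$ and $\langle u_k,v_i\rangle=\langle u_i,v_k\rangle=0$ for $i=1,\dots,k-1$ (where $u_i,v_i$ are maximizers from the earlier steps). They satisfy $0\le\theta_1\le\dots\le\theta_m\le\pi/2$. The Friedrichs angle is $\theta_F:=\theta_{s+1}$ with $s=\dim(\mathcal{U}\cap\mathcal{V})$; it is the smallest non-zero principal angle. *)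

theory Defs
  imports "HOL-Analysis.Analysis"
begin

text \<open>
  The orthogonal projection onto a closed convex set is the library's \<^const>\<open>closest_point\<close>;
  on subspaces it is characterised by orthogonality of the residual:
\<close>

lemma closest_point_subspace_orthogonal:
  fixes C :: "'a::euclidean_space set"
  assumes "subspace C"
  shows "closest_point C x \<in> C"
    and "\<And>y. y \<in> C \<Longrightarrow> orthogonal (x - closest_point C x) y"
proof -
  let ?p = "closest_point C x"
  have C: "closed C" "C \<noteq> {}" "convex C"
    using assms closed_subspace subspace_0 subspace_imp_convex by auto
  show p: "?p \<in> C"
    using C closest_point_in_set by blast
  fix y assume y: "y \<in> C"
  have "(x - ?p) \<bullet> ((?p + y) - ?p) \<le> 0" "(x - ?p) \<bullet> ((?p - y) - ?p) \<le> 0"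
    using assms p y C by (blast intro: closest_point_dot subspace_add subspace_diff)+
  then show "orthogonal (x - ?p) y"
    by (simp add: orthogonal_def)
qed

definition relaxed_proj :: "real \<Rightarrow> 'a::euclidean_space set \<Rightarrow> 'a \<Rightarrow> 'a" where
  "relaxed_proj \<alpha> C x = (1 - \<alpha>) *\<^sub>R x + \<alpha> *\<^sub>R closest_point C x"

definition gap_operator ::
  "real \<Rightarrow> real \<Rightarrow> real \<Rightarrow> 'a::euclidean_space set \<Rightarrow> 'a set \<Rightarrow> 'a \<Rightarrow> 'a" where
  "gap_operator \<alpha> \<alpha>\<^sub>1 \<alpha>\<^sub>2 U V x =
     (1 - \<alpha>) *\<^sub>R x + \<alpha> *\<^sub>R relaxed_proj \<alpha>\<^sub>2 U (relaxed_proj \<alpha>\<^sub>1 V x)"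

definition fix_set :: "('a \<Rightarrow> 'a) \<Rightarrow> 'a set" where
  "fix_set S = {x. S x = x}"

text \<open>
  Indices start at 1; only the values of \<open>u\<close> and \<open>v\<close> at \<open>1, \<dots>, k - 1\<close> matter. The orthogonality
  constraints are crosswise, between \<open>U\<close>-vectors and \<open>V\<close>-vectors.
\<close>

definition principal_feasible ::
  "'a::euclidean_space set \<Rightarrow> 'a set \<Rightarrow> (nat \<Rightarrow> 'a) \<Rightarrow> (nat \<Rightarrow> 'a) \<Rightarrow> nat \<Rightarrow> ('a \<times> 'a) set" where
  "principal_feasible U V u v k =
     {(a, b). a \<in> U \<and> b \<in> V \<and> norm a = 1 \<and> norm b = 1 \<and>
              (\<forall>i\<in>{1..<k}. a \<bullet> v i = 0 \<and> u i \<bullet> b = 0)}"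

definition principal_vectors ::
  "'a::euclidean_space set \<Rightarrow> 'a set \<Rightarrow> (nat \<Rightarrow> 'a) \<Rightarrow> (nat \<Rightarrow> 'a) \<Rightarrow> bool" where
  "principal_vectors U V u v \<longleftrightarrow>
     (\<forall>k\<in>{1..min (dim U) (dim V)}.
        (u k, v k) \<in> principal_feasible U V u v k \<and>
        (\<forall>(a, b)\<in>principal_feasible U V u v k. a \<bullet> b \<le> u k \<bullet> v k))"

text \<open>
  For subspaces and \<open>1 \<le> k \<le> min (dim U) (dim V)\<close> the angle does not depend on the choice of
  maximizers; for other \<open>k\<close> the value is unspecified.
\<close>

definition principal_angle :: "'a::euclidean_space set \<Rightarrow> 'a set \<Rightarrow> nat \<Rightarrow> real" where
  "principal_angle U V k =
     (THE \<theta>. 0 \<le> \<theta> \<and> \<theta> \<le> pi / 2 \<and>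
        (\<exists>u v. principal_vectors U V u v \<and> cos \<theta> = u k \<bullet> v k))"

definition friedrichs_angle :: "'a::euclidean_space set \<Rightarrow> 'a set \<Rightarrow> real" where
  "friedrichs_angle U V = principal_angle U V (dim (U \<inter> V) + 1)"

end

theory Submission
  imports Defs
begin

text \<open>Split \<open>x\<^sub>0 = w + a + b + n\<close> with \<open>w \<in> U \<inter> V\<close>, with \<open>a \<in> U\<close> and \<open>b \<in> V\<close> orthogonal to
  \<open>U \<inter> V\<close>, and with \<open>n\<close> orthogonal to \<open>U + V\<close>. The operator fixes \<open>w\<close> and scales \<open>n\<close> by
  \<open>\<gamma>\<^sup>2\<close>. The \<open>U\<close>-components of the orbit satisfy \<open>a\<^sub>k\<^sub>+\<^sub>2 = M a\<^sub>k\<^sub>+\<^sub>1 - \<gamma>\<^sup>2 a\<^sub>k\<close> with the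
  self-adjoint \<open>M = \<alpha>\<^sub>1\<^sup>2 P\<^sub>U P\<^sub>V - 2 \<gamma>\<close>, and symmetrically for \<open>V\<close>. On \<open>U \<inter> (U \<inter> V)\<^sup>\<bottom>\<close> one has
  \<open>0 \<le> P\<^sub>U P\<^sub>V \<le> cos\<^sup>2 \<theta>\<^sub>F = 4 \<gamma> / \<alpha>\<^sub>1\<^sup>2\<close>, so \<open>\<parallel>M\<parallel> \<le> 2 \<gamma>\<close>, and a quadratic energy of the
  recurrence gives \<open>\<parallel>a\<^sub>k\<parallel> = O(k \<gamma>\<^sup>k\<^sup>-\<^sup>1)\<close>.\<close>

section \<open>Orthogonal projections onto subspaces\<close>

text \<open>Both \<open>p\<close> and the closest point lie in \<open>C\<close> and have residual
  orthogonal to \<open>C\<close>, so their difference is orthogonal to itself.\<close>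

lemma closest_point_subspaceI:
  fixes C :: "'a::euclidean_space set"
  assumes C: "subspace C" and p: "p \<in> C" and orth: "\<And>y. y \<in> C \<Longrightarrow> (x - p) \<bullet> y = 0"
  shows "closest_point C x = p"
proof -
  let ?q = "closest_point C x"
  have d: "p - ?q \<in> C"
    using C p closest_point_subspace_orthogonal(1)[OF C] by (simp add: subspace_diff)
  have "(x - ?q) \<bullet> (p - ?q) = 0"
    using closest_point_subspace_orthogonal(2)[OF C d] by (simp add: orthogonal_def)
  moreover have "(x - p) \<bullet> (p - ?q) = 0"
    using orth[OF d] .
  ultimately have "(p - ?q) \<bullet> (p - ?q) = 0"
    by (simp add: inner_diff_left)
  then show ?thesis by simp
qed

lemma closest_point_subspace_inner:
  fixes C :: "'a::euclidean_space set"
  assumes "subspace C" "y \<in> C"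
  shows "closest_point C x \<bullet> y = x \<bullet> y"
  using closest_point_subspace_orthogonal(2)[OF assms, of x]
  by (simp add: orthogonal_def inner_diff_left)

lemma linear_closest_point_subspace:
  fixes C :: "'a::euclidean_space set"
  assumes C: "subspace C"
  shows "linear (closest_point C)"
proof (rule linearI)
  note in_C = closest_point_subspace_orthogonal(1)[OF C]
    and inner = closest_point_subspace_inner[OF C]
  show "closest_point C (x + y) = closest_point C x + closest_point C y" for x y
    by (rule closest_point_subspaceI[OF C])
      (auto simp: C in_C inner subspace_add inner_diff_left inner_add_left)
  show "closest_point C (r *\<^sub>R x) = r *\<^sub>R closest_point C x" for r x
    by (rule closest_point_subspaceI[OF C])
      (auto simp: C in_C inner subspace_scale inner_diff_left)
qed

section \<open>The Friedrichs angle\<close>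

text \<open>For vectors of \<open>U\<close>, orthogonality to \<open>f\<close> is orthogonality to
  the projection of \<open>f\<close> onto \<open>U\<close>. At most \<open>card F\<close>
  projections cannot span \<open>U\<close>, which leaves a direction in \<open>U\<close> orthogonal
  to all of them.\<close>

lemma unit_vector_orthogonal_to_finite:
  fixes U :: "'a::euclidean_space set"
  assumes U: "subspace U" and F: "finite F" "card F < dim U"
  obtains a where "a \<in> U" "norm a = 1" "\<And>f. f \<in> F \<Longrightarrow> a \<bullet> f = 0"
proof -
  let ?G = "closest_point U ` F"
  have G: "?G \<subseteq> U"
    using closest_point_subspace_orthogonal(1)[OF U] by blast
  have "dim ?G \<le> card F"
    using F(1) by (meson card_image_le dim_le_card' finite_imageI le_trans)
  then have "span ?G \<noteq> span U"
    using F(2) by (metis dim_span not_le)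
  then have "span ?G \<subset> span U"
    using G span_mono by blast
  then obtain y where y: "y \<noteq> 0" "y \<in> span U" "\<And>z. z \<in> span ?G \<Longrightarrow> orthogonal y z"
    using orthogonal_to_subspace_exists_gen by metis
  have yU: "y \<in> U" using y(2) U by (metis span_eq_iff)
  show thesis
  proof
    show "(1 / norm y) *\<^sub>R y \<in> U" using U yU by (simp add: subspace_scale)
    show "norm ((1 / norm y) *\<^sub>R y) = 1" using y(1) by simp
    fix f assume "f \<in> F"
    then have "y \<bullet> closest_point U f = 0"
      using y(3) by (simp add: span_base orthogonal_def)
    then have "y \<bullet> f = 0"
      using closest_point_subspace_inner[OF U yU] by (simp add: inner_commute)
    then show "((1 / norm y) *\<^sub>R y) \<bullet> f = 0" by simp
  qed
qed

text \<open>The feasible pairs form a closed subset of a product of two compact unit spheres. The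
  set is nonempty because each factor carries only \<open>k - 1\<close> linear constraints, fewer
  than its dimension.\<close>

lemma principal_feasible_maximizer:
  fixes U V :: "'a::euclidean_space set"
  assumes U: "subspace U" and V: "subspace V" and k: "1 \<le> k" "k \<le> min (dim U) (dim V)"
  obtains a b where "(a, b) \<in> principal_feasible U V u v k"
    "\<And>a' b'. (a', b') \<in> principal_feasible U V u v k \<Longrightarrow> a' \<bullet> b' \<le> a \<bullet> b"
proof -
  let ?F = "principal_feasible U V u v k"
  have card_small: "card (f ` {1..<k}) < min (dim U) (dim V)" for f :: "nat \<Rightarrow> 'a"
    using card_image_le[of "{1..<k}" f] k by auto
  obtain a where a: "a \<in> U" "norm a = 1" "\<And>i. i \<in> {1..<k} \<Longrightarrow> a \<bullet> v i = 0"
    using unit_vector_orthogonal_to_finite[OF U, of "v ` {1..<k}"] card_small[of v]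
    by (metis (no_types, lifting) finite_imageI finite_atLeastLessThan imageI min_less_iff_conj)
  obtain b where b: "b \<in> V" "norm b = 1" "\<And>i. i \<in> {1..<k} \<Longrightarrow> b \<bullet> u i = 0"
    using unit_vector_orthogonal_to_finite[OF V, of "u ` {1..<k}"] card_small[of u]
    by (metis (no_types, lifting) finite_imageI finite_atLeastLessThan imageI min_less_iff_conj)
  have "(a, b) \<in> ?F"
    using a b by (auto simp: principal_feasible_def inner_commute)
  then have ne: "?F \<noteq> {}" by blast
  have F_eq: "?F = ((U \<inter> sphere 0 1) \<times> (V \<inter> sphere 0 1)) \<inter>
      (\<Inter>i\<in>{1..<k}. {p. fst p \<bullet> v i = 0} \<inter> {p. u i \<bullet> snd p = 0})"
    by (auto simp: principal_feasible_def)
  have "compact ((U \<inter> sphere 0 1) \<times> (V \<inter> sphere 0 1))"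
    by (intro compact_Times closed_Int_compact closed_subspace U V compact_sphere)
  moreover have "closed (\<Inter>i\<in>{1..<k}. {p. fst p \<bullet> v i = 0} \<inter> {p. u i \<bullet> snd p = 0})"
    by (intro closed_INT ballI closed_Int closed_Collect_eq continuous_intros)
  ultimately have "compact ?F"
    unfolding F_eq by (rule compact_Int_closed)
  moreover have "continuous_on ?F (\<lambda>p. fst p \<bullet> snd p)"
    by (intro continuous_intros)
  ultimately obtain p where p: "p \<in> ?F" "\<And>q. q \<in> ?F \<Longrightarrow> fst q \<bullet> snd q \<le> fst p \<bullet> snd p"
    using continuous_attains_sup[OF _ ne] by blast
  show thesis
    using p(1) p(2)[of "(_, _)"] that[of "fst p" "snd p"] by simp
qed

lemma principal_feasible_cong:
  assumes "\<And>i. i \<in> {1..<k} \<Longrightarrow> u i = u' i \<and> v i = v' i"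
  shows "principal_feasible U V u v k = principal_feasible U V u' v' k"
  using assms unfolding principal_feasible_def by auto

text \<open>Greedy construction: the feasible set at index \<open>k\<close> reads only entries below
  \<open>k\<close>, so setting entry \<open>Suc j\<close> to a new maximizer leaves all conditions
  up to \<open>j\<close> intact.\<close>

lemma principal_vectors_exist:
  fixes U V :: "'a::euclidean_space set"
  assumes U: "subspace U" and V: "subspace V"
  obtains u v where "principal_vectors U V u v"
proof -
  let ?P = "\<lambda>u v k. (u k, v k) \<in> principal_feasible U V u v k \<and>
        (\<forall>(a, b)\<in>principal_feasible U V u v k. a \<bullet> b \<le> u k \<bullet> v k)"
  have "\<exists>u v. \<forall>k\<in>{1..j}. ?P u v k" if "j \<le> min (dim U) (dim V)" for j
    using that
  proof (induction j)
    case 0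
    show ?case by simp
  next
    case (Suc j)
    then obtain u v where uv: "\<And>k. k \<in> {1..j} \<Longrightarrow> ?P u v k"
      by (metis Suc_leD)
    obtain a b where ab: "(a, b) \<in> principal_feasible U V u v (Suc j)"
      "\<And>a' b'. (a', b') \<in> principal_feasible U V u v (Suc j) \<Longrightarrow> a' \<bullet> b' \<le> a \<bullet> b"
      using principal_feasible_maximizer[OF U V _ Suc.prems, of u v] by auto
    let ?u = "u(Suc j := a)" and ?v = "v(Suc j := b)"
    have same: "principal_feasible U V ?u ?v k = principal_feasible U V u v k" if "k \<le> Suc j" for k
      using that by (intro principal_feasible_cong) auto
    have "?P ?u ?v k" if "k \<in> {1..Suc j}" for k
    proof (cases "k = Suc j")
      case True
      then show ?thesis using ab same[of k] by auto
    next
      case False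
      then show ?thesis using uv[of k] that same[of k] by auto
    qed
    then show ?case by blast
  qed
  then show thesis
    using that unfolding principal_vectors_def by blast
qed

text \<open>By induction the earlier \<open>u i\<close> and \<open>v i\<close> agree, so some unit
  vector \<open>w\<close> of \<open>U \<inter> V\<close> is orthogonal to all of them and
  \<open>(w, w)\<close> is feasible with value 1. Unit vectors with inner product at least 1
  coincide.\<close>

lemma principal_vectors_eq_on_Int:
  fixes U V :: "'a::euclidean_space set"
  assumes U: "subspace U" and V: "subspace V" and uv: "principal_vectors U V u v"
    and "k \<in> {1..dim (U \<inter> V)}"
  shows "u k = v k"
  using assms(4)
proof (induction k rule: less_induct)
  case (less k)
  have le: "dim (U \<inter> V) \<le> min (dim U) (dim V)"
    by (simp add: dim_subset)
  have feas: "(u k, v k) \<in> principal_feasible U V u v k"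
    and max: "\<And>a b. (a, b) \<in> principal_feasible U V u v k \<Longrightarrow> a \<bullet> b \<le> u k \<bullet> v k"
    using uv less.prems le unfolding principal_vectors_def by auto
  have "card (u ` {1..<k}) < dim (U \<inter> V)"
    using card_image_le[of "{1..<k}" u] less.prems by auto
  then obtain w where w: "w \<in> U \<inter> V" "norm w = 1" "\<And>f. f \<in> u ` {1..<k} \<Longrightarrow> w \<bullet> f = 0"
    using unit_vector_orthogonal_to_finite[OF subspace_inter[OF U V], of "u ` {1..<k}"] by blast
  have "u i = v i" if "i \<in> {1..<k}" for i
    using less.IH[of i] less.prems that by auto
  then have "(w, w) \<in> principal_feasible U V u v k"
    using w by (force simp: principal_feasible_def inner_commute)
  then have "1 \<le> u k \<bullet> v k"
    using max w(2) by (metis norm_eq_1)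
  moreover have "u k \<bullet> u k = 1" "v k \<bullet> v k = 1"
    using feas by (auto simp: principal_feasible_def norm_eq_1)
  ultimately have "(u k - v k) \<bullet> (u k - v k) \<le> 0"
    by (simp add: inner_diff_left inner_diff_right inner_commute)
  then show ?case
    by (metis inner_eq_zero_iff inner_ge_zero order_antisym right_minus_eq)
qed

text \<open>The first \<open>dim (U \<inter> V)\<close> principal vectors are common to both
  sequences and orthonormal, hence a basis of \<open>U \<inter> V\<close>; the crosswise constraints
  become orthogonality to \<open>U \<inter> V\<close>. The right-hand side is free of
  \<open>u\<close> and \<open>v\<close>, which makes the Friedrichs angle independent of the
  maximizers.\<close>

lemma principal_feasible_Suc_dim_Int:
  fixes U V :: "'a::euclidean_space set"
  assumes U: "subspace U" and V: "subspace V" and uv: "principal_vectors U V u v"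
  shows "principal_feasible U V u v (dim (U \<inter> V) + 1) =
    {(a, b). a \<in> U \<and> b \<in> V \<and> norm a = 1 \<and> norm b = 1 \<and>
             (\<forall>w\<in>U \<inter> V. a \<bullet> w = 0 \<and> b \<bullet> w = 0)}"
proof -
  let ?W = "U \<inter> V" and ?I = "{1..dim (U \<inter> V)}"
  note eq = principal_vectors_eq_on_Int[OF U V uv]
  have le: "dim ?W \<le> min (dim U) (dim V)"
    by (simp add: dim_subset)
  have feas: "(u k, v k) \<in> principal_feasible U V u v k" if "k \<in> ?I" for k
    using uv that le unfolding principal_vectors_def by auto
  have W: "u k \<in> ?W" and unit: "norm (u k) = 1" if "k \<in> ?I" for k
    using feas[OF that] eq[OF that] by (auto simp: principal_feasible_def)
  have orth_less: "u k \<bullet> u i = 0" if "i \<in> ?I" "k \<in> ?I" "i < k" for i k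
    using feas[OF that(2)] eq[OF that(1)] that by (auto simp: principal_feasible_def)
  have orth: "u k \<bullet> u i = 0" if "i \<in> ?I" "k \<in> ?I" "i \<noteq> k" for i k
    using orth_less that by (metis inner_commute nat_neq_iff)
  have inj: "inj_on u ?I"
  proof (rule inj_onI, rule ccontr)
    fix i k assume ik: "i \<in> ?I" "k \<in> ?I" "u i = u k" "i \<noteq> k"
    then have "u i \<bullet> u i = 0" using orth by metis
    then show False using unit[OF ik(1)] by simp
  qed
  have "pairwise orthogonal (u ` ?I)"
  proof (rule pairwiseI)
    fix p q assume "p \<in> u ` ?I" "q \<in> u ` ?I" "p \<noteq> q"
    then obtain i k where "i \<in> ?I" "k \<in> ?I" "p = u k" "q = u i" "i \<noteq> k" by blast
    then show "orthogonal p q" using orth by (simp add: orthogonal_def)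
  qed
  moreover have "0 \<notin> u ` ?I"
    using unit by force
  ultimately have "independent (u ` ?I)"
    by (rule pairwise_orthogonal_independent)
  moreover have "card (u ` ?I) = dim ?W"
    using card_image[OF inj] by simp
  ultimately have span: "?W \<subseteq> span (u ` ?I)"
    using W by (intro card_ge_dim_independent) auto
  have "(\<forall>i\<in>?I. a \<bullet> u i = 0) \<longleftrightarrow> (\<forall>w\<in>?W. a \<bullet> w = 0)" for a
  proof
    assume *: "\<forall>i\<in>?I. a \<bullet> u i = 0"
    show "\<forall>w\<in>?W. a \<bullet> w = 0"
    proof
      fix w assume "w \<in> ?W"
      then have "orthogonal a w"
        using span * by (intro orthogonal_to_span[of w "u ` ?I"]) (auto simp: orthogonal_def)
      then show "a \<bullet> w = 0" by (simp add: orthogonal_def)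
    qed
  qed (use W in blast)
  moreover have "{1..<dim ?W + 1} = ?I" by auto
  moreover have "(\<forall>i\<in>?I. a \<bullet> v i = 0 \<and> u i \<bullet> b = 0) \<longleftrightarrow>
      (\<forall>i\<in>?I. a \<bullet> u i = 0) \<and> (\<forall>i\<in>?I. b \<bullet> u i = 0)" for a b
    using eq by (auto simp: inner_commute)
  ultimately show ?thesis
    unfolding principal_feasible_def by auto
qed

lemma friedrichs_angle:
  fixes U V :: "'a::euclidean_space set"
  assumes U: "subspace U" and V: "subspace V" and dim: "dim (U \<inter> V) < min (dim U) (dim V)"
  shows friedrichs_angle_bounds: "0 < friedrichs_angle U V" "friedrichs_angle U V \<le> pi / 2"
    and inner_le_cos_friedrichs_angle:
      "\<And>a b. \<lbrakk>a \<in> U; b \<in> V; \<And>w. w \<in> U \<inter> V \<Longrightarrow> a \<bullet> w = 0; \<And>w. w \<in> U \<inter> V \<Longrightarrow> b \<bullet> w = 0\<rbrakk>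
        \<Longrightarrow> a \<bullet> b \<le> cos (friedrichs_angle U V) * norm a * norm b"
proof -
  let ?k = "dim (U \<inter> V) + 1"
  let ?F = "{(a, b). a \<in> U \<and> b \<in> V \<and> norm a = 1 \<and> norm b = 1 \<and>
             (\<forall>w\<in>U \<inter> V. a \<bullet> w = 0 \<and> b \<bullet> w = 0)}"
  have max: "(u ?k, v ?k) \<in> ?F" "\<And>a b. (a, b) \<in> ?F \<Longrightarrow> a \<bullet> b \<le> u ?k \<bullet> v ?k"
    if "principal_vectors U V u v" for u v
  proof -
    have "?k \<in> {1..min (dim U) (dim V)}" using dim by simp
    then have "(u ?k, v ?k) \<in> principal_feasible U V u v ?k"
      "\<forall>(a, b)\<in>principal_feasible U V u v ?k. a \<bullet> b \<le> u ?k \<bullet> v ?k"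
      using that unfolding principal_vectors_def by blast+
    then show "(u ?k, v ?k) \<in> ?F" "\<And>a b. (a, b) \<in> ?F \<Longrightarrow> a \<bullet> b \<le> u ?k \<bullet> v ?k"
      unfolding principal_feasible_Suc_dim_Int[OF U V that] by blast+
  qed
  obtain u v where uv: "principal_vectors U V u v"
    using principal_vectors_exist[OF U V] .
  let ?c = "u ?k \<bullet> v ?k"
  note F = max[OF uv]
  \<comment> \<open>Flipping one sign keeps the pair feasible, so the maximum also dominates its own
    negative.\<close>
  have "(- u ?k, v ?k) \<in> ?F"
    using F(1) U by (auto simp: subspace_neg)
  from F(2)[OF this] have c0: "0 \<le> ?c" by simp
  \<comment> \<open>Value 1 would force \<open>u ?k = v ?k\<close>, a unit vector of
    \<open>U \<inter> V\<close> that is orthogonal to \<open>U \<inter> V\<close>.\<close>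
  have c1: "?c < 1"
  proof (rule ccontr)
    assume "\<not> ?c < 1"
    moreover have uu: "u ?k \<bullet> u ?k = 1" "v ?k \<bullet> v ?k = 1"
      using F(1) by (auto simp: norm_eq_1)
    ultimately have "(u ?k - v ?k) \<bullet> (u ?k - v ?k) \<le> 0"
      by (simp add: inner_diff_left inner_diff_right inner_commute)
    then have "u ?k = v ?k"
      by (metis inner_eq_zero_iff inner_ge_zero order_antisym right_minus_eq)
    then have "u ?k \<bullet> u ?k = 0" using F(1) by auto
    then show False using uu by simp
  qed
  have angle: "friedrichs_angle U V = arccos ?c"
    unfolding friedrichs_angle_def principal_angle_def
  proof (rule the_equality)
    have "0 \<le> arccos ?c" "arccos ?c \<le> pi / 2" "cos (arccos ?c) = ?c"
      using c0 c1 arccos_le_arccos[of 0 ?c] by (auto intro: arccos_lbound)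
    then show "0 \<le> arccos ?c \<and> arccos ?c \<le> pi / 2 \<and>
        (\<exists>u v. principal_vectors U V u v \<and> cos (arccos ?c) = u ?k \<bullet> v ?k)"
      using uv by blast
  next
    fix \<theta> assume "0 \<le> \<theta> \<and> \<theta> \<le> pi / 2 \<and>
        (\<exists>u v. principal_vectors U V u v \<and> cos \<theta> = u ?k \<bullet> v ?k)"
    then obtain u' v' where \<theta>: "0 \<le> \<theta>" "\<theta> \<le> pi / 2" "principal_vectors U V u' v'"
      "cos \<theta> = u' ?k \<bullet> v' ?k" by blast
    have "u' ?k \<bullet> v' ?k = ?c"
      using max[OF uv] max[OF \<theta>(3)] by (meson order_antisym)
    then show "\<theta> = arccos ?c"
      using \<theta> by (metis arccos_cos field_sum_of_halves le_add_same_cancel1 order_trans pi_half_ge_zero)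
  qed
  moreover have "arccos ?c \<le> pi / 2" "0 < arccos ?c"
    using c0 c1 arccos_le_arccos[of 0 ?c] arccos_less_arccos[of ?c 1] by auto
  ultimately show "0 < friedrichs_angle U V" "friedrichs_angle U V \<le> pi / 2"
    by simp_all
  show "a \<bullet> b \<le> cos (friedrichs_angle U V) * norm a * norm b"
    if "a \<in> U" "b \<in> V" "\<And>w. w \<in> U \<inter> V \<Longrightarrow> a \<bullet> w = 0" "\<And>w. w \<in> U \<inter> V \<Longrightarrow> b \<bullet> w = 0" for a b
  proof (cases "a = 0 \<or> b = 0")
    case False
    then have "((1 / norm a) *\<^sub>R a, (1 / norm b) *\<^sub>R b) \<in> ?F"
      using that U V by (auto simp: subspace_scale)
    from F(2)[OF this] have "a \<bullet> b / (norm a * norm b) \<le> ?c"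
      by (simp add: mult.commute)
    moreover have "cos (friedrichs_angle U V) = ?c"
      using angle c0 c1 by simp
    ultimately show ?thesis
      using False by (simp add: divide_simps mult_ac split: if_splits)
  qed auto
qed

section \<open>Second-order recurrences\<close>

text \<open>The energy \<open>\<parallel>y\<^sub>k\<^sub>+\<^sub>1\<parallel>\<^sup>2 - \<langle>M y\<^sub>k\<^sub>+\<^sub>1, y\<^sub>k\<rangle> + g\<^sup>2 \<parallel>y\<^sub>k\<parallel>\<^sup>2\<close> is multiplied by \<open>g\<^sup>2\<close> in each step, and it
  dominates \<open>(\<parallel>y\<^sub>k\<^sub>+\<^sub>1\<parallel> - g \<parallel>y\<^sub>k\<parallel>)\<^sup>2\<close>.\<close>

lemma second_order_recurrence_bound:
  fixes y :: "nat \<Rightarrow> 'a::real_inner"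
  assumes g: "0 \<le> g"
    and rec: "\<And>k. y (Suc (Suc k)) = M (y (Suc k)) - g\<^sup>2 *\<^sub>R y k"
    and sym: "\<And>i j. M (y i) \<bullet> y j = y i \<bullet> M (y j)"
    and M: "\<And>i. norm (M (y i)) \<le> 2 * g * norm (y i)"
  obtains C where "0 \<le> C" "\<And>k. norm (y (Suc k)) \<le> g * norm (y k) + C * g ^ k"
proof -
  define E where
    "E k = y (Suc k) \<bullet> y (Suc k) - M (y (Suc k)) \<bullet> y k + g\<^sup>2 * (y k \<bullet> y k)" for k
  have step: "E (Suc k) = g\<^sup>2 * E k" for k
  proof -
    \<comment> \<open>Moving \<open>M\<close> across turns the first two terms of
      \<open>E (Suc k)\<close> into
      \<open>y (Suc (Suc k)) \<bullet> (y (Suc (Suc k)) - M (y (Suc k)))\<close>, and the recurrence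
      replaces the bracket by \<open>- g\<^sup>2 *\<^sub>R y k\<close>.\<close>
    have "M (y (Suc (Suc k))) \<bullet> y (Suc k) = y (Suc (Suc k)) \<bullet> M (y (Suc k))"
      by (rule sym)
    then show ?thesis
      unfolding E_def rec[of k]
      by (simp add: inner_diff_left inner_diff_right inner_commute algebra_simps power2_eq_square)
  qed
  have E: "E k = (g ^ k)\<^sup>2 * E 0" for k
    by (induction k) (simp_all add: step power_mult_distrib)
  have lower: "(norm (y (Suc k)) - g * norm (y k))\<^sup>2 \<le> E k" for k
  proof -
    have "M (y (Suc k)) \<bullet> y k \<le> norm (M (y (Suc k))) * norm (y k)"
      by (rule norm_cauchy_schwarz)
    also have "\<dots> \<le> 2 * g * norm (y (Suc k)) * norm (y k)"
      using M by (intro mult_right_mono) auto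
    finally show ?thesis
      unfolding E_def by (simp add: power2_norm_eq_inner[symmetric] power2_eq_square algebra_simps)
  qed
  have E0: "0 \<le> E 0"
    using lower[of 0] by (meson order_trans zero_le_power2)
  show thesis
  proof
    show "0 \<le> sqrt (E 0)" using E0 by simp
    fix k
    have "(norm (y (Suc k)) - g * norm (y k))\<^sup>2 \<le> (sqrt (E 0) * g ^ k)\<^sup>2"
      using lower[of k] E[of k] E0 by (simp add: power_mult_distrib mult.commute)
    then have "norm (y (Suc k)) - g * norm (y k) \<le> sqrt (E 0) * g ^ k"
      by (rule power2_le_imp_le) (use E0 g in simp)
    then show "norm (y (Suc k)) \<le> g * norm (y k) + sqrt (E 0) * g ^ k" by simp
  qed
qed

text \<open>The forcing term resonates with \<open>g\<close> and costs a factor linear in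
  \<open>k\<close>, which a slightly larger rate \<open>\<nu>\<close> absorbs: \<open>K\<close>
  satisfies \<open>g * K + C \<le> \<nu> * K\<close>. The remaining gap between \<open>\<nu>\<close>
  and \<open>\<mu>\<close> turns \<open>K\<close> into the arbitrarily small
  \<open>\<epsilon>\<close>.\<close>

lemma eventually_le_power_of_recurrence:
  fixes r :: "nat \<Rightarrow> real"
  assumes g: "0 \<le> g" "g < \<mu>" and C: "0 \<le> C" and \<epsilon>: "0 < \<epsilon>"
    and r0: "0 \<le> r 0" and rec: "\<And>k. r (Suc k) \<le> g * r k + C * g ^ k"
  shows "eventually (\<lambda>k. r k \<le> \<epsilon> * \<mu> ^ k) sequentially"
proof -
  obtain \<nu> where \<nu>: "g < \<nu>" "\<nu> < \<mu>" using g(2) dense by blast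
  define K where "K = r 0 + C / (\<nu> - g)"
  have K: "0 \<le> K" "C \<le> (\<nu> - g) * K"
    using \<nu> C r0 by (auto simp: K_def distrib_left)
  have bound: "r k \<le> K * \<nu> ^ k" for k
  proof (induction k)
    case 0
    show ?case using \<nu> C by (simp add: K_def)
  next
    case (Suc k)
    have "r (Suc k) \<le> g * (K * \<nu> ^ k) + C * \<nu> ^ k"
      using rec[of k] mult_left_mono[OF Suc g(1)] power_mono[of g \<nu> k] g \<nu> C
      by (smt (verit) mult_left_mono)
    also have "\<dots> = (g * K + C) * \<nu> ^ k" by (simp add: algebra_simps)
    also have "\<dots> \<le> (\<nu> * K) * \<nu> ^ k"
      using K g \<nu> by (intro mult_right_mono) (auto simp: algebra_simps)
    finally show ?case by (simp add: mult_ac)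
  qed
  have "(\<lambda>k. K * (\<nu> / \<mu>) ^ k) \<longlonglongrightarrow> K * 0"
    using g \<nu> by (intro tendsto_mult_left LIMSEQ_realpow_zero) auto
  then have "eventually (\<lambda>k. K * (\<nu> / \<mu>) ^ k < \<epsilon>) sequentially"
    using \<epsilon> by (simp add: order_tendstoD)
  then show ?thesis
  proof (rule eventually_mono)
    fix k assume "K * (\<nu> / \<mu>) ^ k < \<epsilon>"
    moreover have "0 < \<mu> ^ k" using g by simp
    ultimately have "K * \<nu> ^ k \<le> \<epsilon> * \<mu> ^ k"
      by (simp add: power_divide field_simps)
    then show "r k \<le> \<epsilon> * \<mu> ^ k" using bound[of k] by linarith
  qed
qed

section \<open>The relaxed projection product\<close>

text \<open>The orthogonal complement of \<open>U \<inter> V\<close> within \<open>U\<close>. The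
  cosine of the Friedrichs angle bounds inner products between this space and its counterpart in
  \<open>V\<close>.\<close>

definition off_intersection :: "'a::euclidean_space set \<Rightarrow> 'a set \<Rightarrow> 'a set" where
  "off_intersection U V = {a \<in> U. \<forall>w\<in>U \<inter> V. a \<bullet> w = 0}"

lemma subspace_off_intersection:
  assumes "subspace U"
  shows "subspace (off_intersection U V)"
  using assms
  by (auto simp: off_intersection_def subspace_def inner_add_left)

lemma closest_point_off_intersection:
  assumes V: "subspace V" and a: "a \<in> off_intersection U V"
  shows "closest_point V a \<in> off_intersection V U"
  using a closest_point_subspace_orthogonal(1)[OF V] closest_point_subspace_inner[OF V]
  by (auto simp: off_intersection_def)

text \<open>On \<open>off_intersection U V\<close> the operator
  \<open>\<beta>\<^sup>2 P_U P_V\<close> lies between 0 and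
  \<open>\<beta>\<^sup>2 * c\<^sup>2 = 4 * \<gamma>\<close>, and subtracting
  \<open>2 * \<gamma>\<close> centres this interval at 0. Concretely, with \<open>b = P_V a\<close>
  and \<open>p = P_U b\<close>, one has \<open>p \<bullet> a = b \<bullet> b\<close> and
  \<open>p \<bullet> p \<le> c\<^sup>2 * (b \<bullet> b)\<close>; expanding the square gives the
  bound.\<close>

lemma norm_two_projections_le:
  fixes U V :: "'a::euclidean_space set"
  assumes U: "subspace U" and V: "subspace V" and \<gamma>: "0 \<le> \<gamma>" and c: "0 \<le> c"
    and angle: "\<And>a b. \<lbrakk>a \<in> off_intersection U V; b \<in> off_intersection V U\<rbrakk>
      \<Longrightarrow> a \<bullet> b \<le> c * norm a * norm b"
    and \<beta>: "\<beta>\<^sup>2 * c\<^sup>2 = 4 * \<gamma>" and a: "a \<in> off_intersection U V"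
  shows "norm (\<beta>\<^sup>2 *\<^sub>R closest_point U (closest_point V a) - (2 * \<gamma>) *\<^sub>R a) \<le> 2 * \<gamma> * norm a"
proof -
  let ?b = "closest_point V a"
  let ?p = "closest_point U ?b"
  have b: "?b \<in> off_intersection V U"
    using closest_point_off_intersection[OF V a] .
  have p: "?p \<in> off_intersection U V"
    using closest_point_off_intersection[OF U b] .
  have "?p \<bullet> ?p = ?p \<bullet> ?b"
    using closest_point_subspace_inner[OF U, of ?p ?b] p
    by (simp add: off_intersection_def inner_commute)
  then have "norm ?p * norm ?p \<le> (c * norm ?b) * norm ?p"
    using angle[OF p b] by (simp add: power2_norm_eq_inner[symmetric] power2_eq_square mult_ac)
  then have "norm ?p \<le> c * norm ?b"
    using c by (cases "norm ?p = 0") auto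
  then have p_le: "?p \<bullet> ?p \<le> c\<^sup>2 * (?b \<bullet> ?b)"
    using power_mono[of "norm ?p" "c * norm ?b" 2]
    by (simp add: power_mult_distrib power2_norm_eq_inner)
  have "?p \<bullet> a = ?b \<bullet> a"
    using closest_point_subspace_inner[OF U, of a ?b] a by (simp add: off_intersection_def)
  also have "\<dots> = ?b \<bullet> ?b"
    using closest_point_subspace_inner[OF V, of ?b a] b
    by (simp add: off_intersection_def inner_commute)
  finally have pa: "?p \<bullet> a = ?b \<bullet> ?b" .
  have "\<beta>\<^sup>2 * \<beta>\<^sup>2 * (?p \<bullet> ?p) \<le> \<beta>\<^sup>2 * \<beta>\<^sup>2 * (c\<^sup>2 * (?b \<bullet> ?b))"
    using p_le by (intro mult_left_mono) auto
  also have "\<dots> = 4 * \<gamma> * \<beta>\<^sup>2 * (?b \<bullet> ?b)"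
    unfolding \<beta>[symmetric] by (simp add: mult_ac)
  finally have "(norm (\<beta>\<^sup>2 *\<^sub>R ?p - (2 * \<gamma>) *\<^sub>R a))\<^sup>2 \<le> (2 * \<gamma> * norm a)\<^sup>2"
    unfolding power2_norm_eq_inner power_mult_distrib
    by (simp add: inner_diff_left inner_diff_right inner_commute[of a ?p] pa algebra_simps power2_eq_square)
  then show ?thesis
    by (rule power2_le_imp_le) (use \<gamma> in simp)
qed

text \<open>Both sides equal the inner product of the projections of \<open>a\<close> and
  \<open>a'\<close> onto \<open>V\<close>.\<close>

lemma two_projections_symmetric:
  fixes U V :: "'a::euclidean_space set"
  assumes U: "subspace U" and V: "subspace V" and a: "a \<in> U" "a' \<in> U"
  shows "closest_point U (closest_point V a) \<bullet> a' = a \<bullet> closest_point U (closest_point V a')"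
proof -
  have *: "closest_point U (closest_point V x) \<bullet> y = closest_point V y \<bullet> closest_point V x"
    if "y \<in> U" for x y
  proof -
    have "closest_point U (closest_point V x) \<bullet> y = y \<bullet> closest_point V x"
      using closest_point_subspace_inner[OF U that] by (simp add: inner_commute)
    also have "\<dots> = closest_point V y \<bullet> closest_point V x"
      using closest_point_subspace_inner[OF V closest_point_subspace_orthogonal(1)[OF V]] by simp
    finally show ?thesis .
  qed
  show ?thesis
    using *[OF a(1), of a'] *[OF a(2), of a] by (simp add: inner_commute)
qed

lemma two_projections_decay:
  fixes U V :: "'a::euclidean_space set"
  assumes U: "subspace U" and V: "subspace V" and \<gamma>: "0 \<le> \<gamma>" "\<gamma> < \<mu>" and c: "0 \<le> c"
    and angle: "\<And>a b. \<lbrakk>a \<in> off_intersection U V; b \<in> off_intersection V U\<rbrakk>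
      \<Longrightarrow> a \<bullet> b \<le> c * norm a * norm b"
    and \<beta>: "\<beta>\<^sup>2 * c\<^sup>2 = 4 * \<gamma>" and y: "\<And>k. y k \<in> off_intersection U V"
    and rec: "\<And>k. y (Suc (Suc k)) =
      \<beta>\<^sup>2 *\<^sub>R closest_point U (closest_point V (y (Suc k))) - (2 * \<gamma>) *\<^sub>R y (Suc k) - \<gamma>\<^sup>2 *\<^sub>R y k"
    and \<epsilon>: "0 < \<epsilon>"
  shows "eventually (\<lambda>k. norm (y k) \<le> \<epsilon> * \<mu> ^ k) sequentially"
proof -
  define M where "M a = \<beta>\<^sup>2 *\<^sub>R closest_point U (closest_point V a) - (2 * \<gamma>) *\<^sub>R a" for a
  have yU: "y k \<in> U" for k
    using y by (simp add: off_intersection_def)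
  have rec': "y (Suc (Suc k)) = M (y (Suc k)) - \<gamma>\<^sup>2 *\<^sub>R y k" for k
    using rec by (simp add: M_def)
  have sym: "M (y i) \<bullet> y j = y i \<bullet> M (y j)" for i j
    using two_projections_symmetric[OF U V yU yU]
    by (simp add: M_def inner_diff_left inner_diff_right)
  have M: "norm (M (y i)) \<le> 2 * \<gamma> * norm (y i)" for i
    unfolding M_def by (rule norm_two_projections_le[OF U V \<gamma>(1) c angle \<beta> y])
  obtain C where "0 \<le> C" "\<And>k. norm (y (Suc k)) \<le> \<gamma> * norm (y k) + C * \<gamma> ^ k"
    using second_order_recurrence_bound[OF \<gamma>(1), of y M] rec' sym M by metis
  then show ?thesis
    using eventually_le_power_of_recurrence[OF \<gamma> _ \<epsilon>, of C "\<lambda>k. norm (y k)"] by simp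
qed

section \<open>Relaxed projections and the splitting of the space\<close>

lemma linear_relaxed_proj:
  assumes "subspace C"
  shows "linear (relaxed_proj \<alpha> C)"
  by (rule linearI)
    (simp_all add: relaxed_proj_def linear_add[OF linear_closest_point_subspace[OF assms]]
      linear_scale[OF linear_closest_point_subspace[OF assms]] algebra_simps)

lemma relaxed_proj_self:
  assumes "subspace C" "x \<in> C"
  shows "relaxed_proj \<alpha> C x = x"
  using assms by (simp add: relaxed_proj_def closest_point_self algebra_simps)

lemma relaxed_proj_orthogonal:
  assumes "subspace C" "\<And>y. y \<in> C \<Longrightarrow> x \<bullet> y = 0"
  shows "relaxed_proj \<alpha> C x = (1 - \<alpha>) *\<^sub>R x"
proof -
  have "closest_point C x = 0"
    using assms by (intro closest_point_subspaceI) (auto simp: subspace_0)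
  then show ?thesis by (simp add: relaxed_proj_def)
qed

text \<open>Here \<open>a + b\<close> is the projection of \<open>x - ?w\<close> onto the sum
  \<open>?Y\<close> of the two complements, and \<open>n\<close> is the residual. It is orthogonal
  to \<open>?Y\<close> and to \<open>?W\<close>, hence to \<open>U\<close> and \<open>V\<close>,
  since each of their vectors is its projection onto \<open>?W\<close> plus an element of
  \<open>?Y\<close>.\<close>

lemma subspace_pair_decomposition:
  fixes U V :: "'a::euclidean_space set"
  assumes U: "subspace U" and V: "subspace V"
  obtains a b n where "a \<in> off_intersection U V" "b \<in> off_intersection V U"
    "\<And>y. y \<in> U \<or> y \<in> V \<Longrightarrow> n \<bullet> y = 0"
    "x = closest_point (U \<inter> V) x + (a + b) + n"
proof -
  let ?W = "U \<inter> V"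
  let ?Y = "{a + b |a b. a \<in> off_intersection U V \<and> b \<in> off_intersection V U}"
  let ?w = "closest_point ?W x"
  have W: "subspace ?W" using U V by (rule subspace_inter)
  note off = subspace_off_intersection[OF U, of V] subspace_off_intersection[OF V, of U]
  have Y: "subspace ?Y" using off by (rule subspace_sums)
  obtain a b where ab: "a \<in> off_intersection U V" "b \<in> off_intersection V U"
    "closest_point ?Y (x - ?w) = a + b"
    using closest_point_subspace_orthogonal(1)[OF Y, of "x - ?w"] by blast
  define n where "n = x - ?w - (a + b)"
  have nY: "n \<bullet> y = 0" if "y \<in> ?Y" for y
    using closest_point_subspace_orthogonal(2)[OF Y that, of "x - ?w"]
    by (simp add: ab(3) n_def orthogonal_def)
  have nW: "n \<bullet> w = 0" if "w \<in> ?W" for w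
    using ab(1,2) closest_point_subspace_inner[OF W that, of x] that
    by (auto simp: n_def off_intersection_def inner_diff_left inner_add_left)
  have res: "closest_point ?W z \<in> U" "closest_point ?W z \<in> V"
    "w \<in> ?W \<Longrightarrow> (z - closest_point ?W z) \<bullet> w = 0" for z w
    using closest_point_subspace_orthogonal(1)[OF W, of z]
      closest_point_subspace_orthogonal(2)[OF W, of w z] unfolding orthogonal_def by blast+
  have split: "z - closest_point ?W z \<in> off_intersection U V" if "z \<in> U" for z
    using that U res by (auto simp: off_intersection_def subspace_diff)
  have split': "z - closest_point ?W z \<in> off_intersection V U" if "z \<in> V" for z
    using that V res by (auto simp: off_intersection_def subspace_diff)
  have "n \<bullet> z = 0" if "z \<in> U \<or> z \<in> V" for z
  proof -
    have "z - closest_point ?W z \<in> ?Y"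
      using that
    proof
      assume "z \<in> U"
      then show ?thesis
        using split subspace_0[OF off(2)] by (metis (mono_tags, lifting) CollectI add.right_neutral)
    next
      assume "z \<in> V"
      then show ?thesis
        using split' subspace_0[OF off(1)] by (metis (mono_tags, lifting) CollectI add.left_neutral)
    qed
    then show ?thesis
      using nY nW[OF closest_point_subspace_orthogonal(1)[OF W, of z]]
      by (metis (no_types, lifting) add.left_neutral diff_add_cancel inner_right_distrib)
  qed
  then show thesis
    using ab(1,2) by (intro that[of a b n]) (auto simp: n_def)
qed

text \<open>On \<open>U + V\<close> the operator lifts to the map
  \<open>(a, b) \<mapsto> (- \<gamma> a + \<beta> P\<^sub>U (b + \<beta> P\<^sub>V a), - \<gamma> (b + \<beta> P\<^sub>V a))\<close> of \<open>U \<times> V\<close>; along its orbits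
  each component satisfies a second-order recurrence of its own.\<close>

lemma relaxed_projections_converge:
  fixes U V :: "'a::euclidean_space set"
  assumes U: "subspace U" and V: "subspace V" and \<gamma>: "0 \<le> \<gamma>" "\<gamma> < 1" "\<gamma> < \<mu>" and c: "0 \<le> c"
    and angle: "\<And>a b. \<lbrakk>a \<in> off_intersection U V; b \<in> off_intersection V U\<rbrakk>
      \<Longrightarrow> a \<bullet> b \<le> c * norm a * norm b"
    and \<beta>: "\<beta>\<^sup>2 * c\<^sup>2 = 4 * \<gamma>" "\<beta> = 1 + \<gamma>"
    and x: "\<And>k. x (Suc k) = relaxed_proj \<beta> U (relaxed_proj \<beta> V (x k))"
    and \<epsilon>: "0 < \<epsilon>"
  shows "eventually (\<lambda>k. norm (x k - closest_point (U \<inter> V) (x 0)) \<le> \<epsilon> * \<mu> ^ k) sequentially"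
proof -
  let ?P = "closest_point U" and ?Q = "closest_point V"
  let ?w = "closest_point (U \<inter> V) (x 0)"
  let ?T = "\<lambda>z. relaxed_proj \<beta> U (relaxed_proj \<beta> V z)"
  obtain a0 b0 n where dec: "a0 \<in> off_intersection U V" "b0 \<in> off_intersection V U"
    "\<And>y. y \<in> U \<or> y \<in> V \<Longrightarrow> n \<bullet> y = 0" "x 0 = ?w + (a0 + b0) + n"
    using subspace_pair_decomposition[OF U V, of "x 0"] by metis
  define ab where "ab k = ((\<lambda>(a, b). ((- \<gamma>) *\<^sub>R a + \<beta> *\<^sub>R ?P (b + \<beta> *\<^sub>R ?Q a),
      (- \<gamma>) *\<^sub>R (b + \<beta> *\<^sub>R ?Q a))) ^^ k) (a0, b0)" for k
  define a where "a k = fst (ab k)" for k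
  define b where "b k = snd (ab k)" for k
  have ab0: "a 0 = a0" "b 0 = b0"
    by (simp_all add: a_def b_def ab_def)
  have a_Suc: "a (Suc k) = (- \<gamma>) *\<^sub>R a k + \<beta> *\<^sub>R ?P (b k + \<beta> *\<^sub>R ?Q (a k))"
    and b_Suc: "b (Suc k) = (- \<gamma>) *\<^sub>R (b k + \<beta> *\<^sub>R ?Q (a k))" for k
    by (simp_all add: a_def b_def ab_def case_prod_beta)
  note off = subspace_off_intersection[OF U, of V] subspace_off_intersection[OF V, of U]
  have mem: "a k \<in> off_intersection U V \<and> b k \<in> off_intersection V U" for k
  proof (induction k)
    case 0
    show ?case using dec ab0 by simp
  next
    case (Suc k)
    then have s: "b k + \<beta> *\<^sub>R ?Q (a k) \<in> off_intersection V U"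
      using closest_point_off_intersection[OF V]
      by (intro subspace_add[OF off(2)] subspace_scale[OF off(2)]) auto
    then have p: "?P (b k + \<beta> *\<^sub>R ?Q (a k)) \<in> off_intersection U V"
      by (rule closest_point_off_intersection[OF U])
    have "a (Suc k) \<in> off_intersection U V"
      unfolding a_Suc using p Suc by (intro subspace_add[OF off(1)] subspace_scale[OF off(1)]) auto
    moreover have "b (Suc k) \<in> off_intersection V U"
      unfolding b_Suc using s by (rule subspace_scale[OF off(2)])
    ultimately show ?case by simp
  qed
  note lin = linear_add[OF linear_closest_point_subspace] linear_scale[OF linear_closest_point_subspace]
    linear_diff[OF linear_closest_point_subspace] linear_neg[OF linear_closest_point_subspace]
  have double: "(2 * \<gamma>) *\<^sub>R z = \<gamma> *\<^sub>R z + \<gamma> *\<^sub>R z" for z :: 'a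
    unfolding mult_2 by (rule scaleR_add_left)
  have a_rec: "a (Suc (Suc k)) =
      \<beta>\<^sup>2 *\<^sub>R ?P (?Q (a (Suc k))) - (2 * \<gamma>) *\<^sub>R a (Suc k) - \<gamma>\<^sup>2 *\<^sub>R a k" for k
  proof -
    have "a (Suc (Suc k)) = (- \<gamma>) *\<^sub>R a (Suc k) + \<beta> *\<^sub>R ?P (b (Suc k)) + \<beta>\<^sup>2 *\<^sub>R ?P (?Q (a (Suc k)))"
      by (simp add: a_Suc[of "Suc k"] lin U V power2_eq_square algebra_simps)
    \<comment> \<open>This eliminates \<open>b\<close>: \<open>b (Suc k)\<close> is
      \<open>- \<gamma>\<close> times the vector whose projection enters
      \<open>a (Suc k)\<close>.\<close>
    moreover have "\<beta> *\<^sub>R ?P (b (Suc k)) = (- \<gamma>) *\<^sub>R a (Suc k) - \<gamma>\<^sup>2 *\<^sub>R a k"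
      by (simp add: a_Suc b_Suc lin[OF U] power2_eq_square algebra_simps)
    ultimately show ?thesis
      unfolding double by simp
  qed
  have b_rec: "b (Suc (Suc k)) =
      \<beta>\<^sup>2 *\<^sub>R ?Q (?P (b (Suc k))) - (2 * \<gamma>) *\<^sub>R b (Suc k) - \<gamma>\<^sup>2 *\<^sub>R b k" for k
  proof -
    \<comment> \<open>Expresses the \<open>a\<close>-terms through \<open>b\<close>. The factor
      \<open>\<gamma>\<close> stays on the left because it vanishes when the Friedrichs angle is
      \<open>pi / 2\<close>.\<close>
    have Qa: "(\<gamma> * \<beta>) *\<^sub>R ?Q (a k) = - b (Suc k) - \<gamma> *\<^sub>R b k" for k
      by (simp add: b_Suc algebra_simps)
    have "\<beta> *\<^sub>R ?P (b (Suc k)) = (- \<gamma>) *\<^sub>R a (Suc k) - \<gamma>\<^sup>2 *\<^sub>R a k"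
      by (simp add: a_Suc b_Suc lin[OF U] power2_eq_square algebra_simps)
    then have "?Q (\<beta> *\<^sub>R (\<beta> *\<^sub>R ?P (b (Suc k)))) = ?Q (\<beta> *\<^sub>R ((- \<gamma>) *\<^sub>R a (Suc k) - \<gamma>\<^sup>2 *\<^sub>R a k))"
      by simp
    also have "\<dots> = - ((\<gamma> * \<beta>) *\<^sub>R ?Q (a (Suc k))) - \<gamma> *\<^sub>R ((\<gamma> * \<beta>) *\<^sub>R ?Q (a k))"
      by (simp add: lin[OF V] power2_eq_square algebra_simps)
    also have "\<dots> = b (Suc (Suc k)) + (2 * \<gamma>) *\<^sub>R b (Suc k) + \<gamma>\<^sup>2 *\<^sub>R b k"
      unfolding Qa double by (simp add: power2_eq_square algebra_simps)
    finally have "\<beta>\<^sup>2 *\<^sub>R ?Q (?P (b (Suc k))) =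
        b (Suc (Suc k)) + (2 * \<gamma>) *\<^sub>R b (Suc k) + \<gamma>\<^sup>2 *\<^sub>R b k"
      by (simp add: lin[OF V] power2_eq_square)
    then show ?thesis by simp
  qed
  have T_lin: "linear ?T"
    using linear_compose[OF linear_relaxed_proj[OF V] linear_relaxed_proj[OF U]] by (simp add: o_def)
  have T_w: "?T ?w = ?w"
    using closest_point_subspace_orthogonal(1)[OF subspace_inter[OF U V]] U V
    by (simp add: relaxed_proj_self)
  \<comment> \<open>Each relaxed projection multiplies \<open>n\<close> by
    \<open>1 - \<beta> = - \<gamma>\<close>.\<close>
  have T_n: "?T (r *\<^sub>R n) = (\<gamma>\<^sup>2 * r) *\<^sub>R n" for r
    using dec(3) U V by (simp add: relaxed_proj_orthogonal \<beta>(2) power2_eq_square)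
  have T_ab: "?T (a k + b k) = a (Suc k) + b (Suc k)" for k
  proof -
    have aU: "a k \<in> U" and bV: "b k \<in> V"
      using mem by (auto simp: off_intersection_def)
    \<comment> \<open>The part in \<open>V\<close> after the first relaxed projection, which fixes
      \<open>b k\<close> and reflects part of \<open>a k\<close> into \<open>V\<close>; the second
      one then fixes \<open>a k\<close>.\<close>
    define s where "s = b k + \<beta> *\<^sub>R ?Q (a k)"
    have "relaxed_proj \<beta> V (a k + b k) = (- \<gamma>) *\<^sub>R a k + s"
      by (simp add: linear_add[OF linear_relaxed_proj[OF V]] relaxed_proj_self[OF V bV])
        (simp add: relaxed_proj_def s_def \<beta>(2))
    then have "?T (a k + b k) = (- \<gamma>) *\<^sub>R relaxed_proj \<beta> U (a k) + relaxed_proj \<beta> U s"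
      by (simp only: linear_add[OF linear_relaxed_proj[OF U]] linear_scale[OF linear_relaxed_proj[OF U]])
    also have "\<dots> = (- \<gamma>) *\<^sub>R a k + ((- \<gamma>) *\<^sub>R s + \<beta> *\<^sub>R ?P s)"
      by (simp only: relaxed_proj_self[OF U aU]) (simp add: relaxed_proj_def \<beta>(2))
    also have "\<dots> = a (Suc k) + b (Suc k)"
      by (simp add: a_Suc b_Suc s_def)
    finally show ?thesis .
  qed
  have xk: "x k = ?w + (a k + b k) + (\<gamma>\<^sup>2) ^ k *\<^sub>R n" for k
  proof (induction k)
    case 0
    show ?case using dec(4) ab0 by simp
  next
    case (Suc k)
    have "x (Suc k) = ?T ?w + ?T (a k + b k) + ?T ((\<gamma>\<^sup>2) ^ k *\<^sub>R n)"
      unfolding x[of k] Suc using linear_add[OF T_lin] by metis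
    then show ?case
      unfolding T_w T_n T_ab by simp
  qed
  have \<epsilon>3: "0 < \<epsilon> / 3" using \<epsilon> by simp
  have angle': "b \<bullet> a \<le> c * norm b * norm a"
    if "b \<in> off_intersection V U" "a \<in> off_intersection U V" for a b
    using angle[OF that(2,1)] by (simp add: inner_commute mult_ac)
  have ev_a: "eventually (\<lambda>k. norm (a k) \<le> \<epsilon> / 3 * \<mu> ^ k) sequentially"
    using mem a_rec by (intro two_projections_decay[OF U V \<gamma>(1,3) c angle \<beta>(1) _ _ \<epsilon>3]) auto
  have ev_b: "eventually (\<lambda>k. norm (b k) \<le> \<epsilon> / 3 * \<mu> ^ k) sequentially"
    using mem b_rec by (intro two_projections_decay[OF V U \<gamma>(1,3) c angle' \<beta>(1) _ _ \<epsilon>3]) auto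
  \<comment> \<open>The \<open>n\<close>-part decays like \<open>\<gamma>\<^sup>2\<close>, so it
    fits the scalar recurrence at rate \<open>\<gamma>\<close> with zero forcing.\<close>
  have "\<gamma>\<^sup>2 \<le> \<gamma>"
    using \<gamma> by (simp add: power2_eq_square mult_left_le)
  then have "norm ((\<gamma>\<^sup>2) ^ Suc k *\<^sub>R n) \<le> \<gamma> * norm ((\<gamma>\<^sup>2) ^ k *\<^sub>R n) + 0 * \<gamma> ^ k" for k
    using mult_right_mono[of "\<gamma>\<^sup>2" \<gamma> "(\<gamma>\<^sup>2) ^ k * norm n"] by (simp add: mult_ac)
  then have ev_n: "eventually (\<lambda>k. norm ((\<gamma>\<^sup>2) ^ k *\<^sub>R n) \<le> \<epsilon> / 3 * \<mu> ^ k) sequentially"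
    using eventually_le_power_of_recurrence[OF \<gamma>(1,3) order_refl \<epsilon>3, of "\<lambda>k. norm ((\<gamma>\<^sup>2) ^ k *\<^sub>R n)"]
    by (metis norm_ge_zero)
  from ev_a ev_b ev_n show ?thesis
  proof eventually_elim
    case (elim k)
    have "norm (x k - ?w) = norm (a k + b k + (\<gamma>\<^sup>2) ^ k *\<^sub>R n)"
      by (subst xk) (simp add: algebra_simps)
    also have "\<dots> \<le> norm (a k) + norm (b k) + norm ((\<gamma>\<^sup>2) ^ k *\<^sub>R n)"
      by (meson norm_triangle_ineq norm_triangle_mono order_refl)
    finally show ?case using elim by linarith
  qed
qed

section \<open>Fixed points and the rate for the given parameters\<close>

theorem theorem3:
  fixes U V :: "(real ^ 'n) set"
    and S :: "real ^ 'n \<Rightarrow> real ^ 'n"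
    and x :: "nat \<Rightarrow> real ^ 'n"
    and \<theta>\<^sub>F \<alpha> \<alpha>\<^sub>1 \<alpha>\<^sub>2 \<gamma> :: real
  assumes "subspace U" and "subspace V"
    and "dim (U \<inter> V) < min (dim U) (dim V)"
    and "\<theta>\<^sub>F = friedrichs_angle U V"
    and "\<alpha> = 1"
    and "\<alpha>\<^sub>1 = 2 / (1 + sin \<theta>\<^sub>F)"
    and "\<alpha>\<^sub>2 = 2 / (1 + sin \<theta>\<^sub>F)"
    and "\<gamma> = (1 - sin \<theta>\<^sub>F) / (1 + sin \<theta>\<^sub>F)"
    and "S = gap_operator \<alpha> \<alpha>\<^sub>1 \<alpha>\<^sub>2 U V"
    and "\<And>k. x (Suc k) = S (x k)"
  shows "\<forall>\<mu>\<in>{\<gamma><..<1}. \<exists>N. \<forall>k\<ge>N.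
           norm (x k - closest_point (fix_set S) (x 0)) \<le> \<mu> ^ k * norm (x 0)"
proof
  fix \<mu> assume \<mu>: "\<mu> \<in> {\<gamma><..<1}"
  note U = assms(1) and V = assms(2)
  let ?s = "sin \<theta>\<^sub>F" and ?c = "cos \<theta>\<^sub>F"
  have \<theta>: "0 < \<theta>\<^sub>F" "\<theta>\<^sub>F \<le> pi / 2"
    using friedrichs_angle_bounds[OF U V assms(3)] by (simp_all add: assms(4))
  have s: "0 < ?s" "?s \<le> 1" and c: "0 \<le> ?c"
    using \<theta> by (auto intro: sin_gt_zero cos_ge_zero)
  have \<gamma>: "0 \<le> \<gamma>" "\<gamma> < 1" and \<beta>: "\<alpha>\<^sub>1 = 1 + \<gamma>"
    using s by (auto simp: assms(6,8) field_simps)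
  \<comment> \<open>One factor \<open>1 + ?s\<close> cancels against
    \<open>\<alpha>\<^sub>1\<^sup>2 = 4 / (1 + ?s)\<^sup>2\<close>, leaving
    \<open>4 * \<gamma>\<close>.\<close>
  have "?c\<^sup>2 = (1 - ?s) * (1 + ?s)"
    using sin_cos_squared_add[of \<theta>\<^sub>F] by (simp add: algebra_simps power2_eq_square)
  then have \<beta>c: "\<alpha>\<^sub>1\<^sup>2 * ?c\<^sup>2 = 4 * \<gamma>"
    using s by (simp add: assms(6,8) power2_eq_square divide_simps)
  have S: "S z = relaxed_proj \<alpha>\<^sub>1 U (relaxed_proj \<alpha>\<^sub>1 V z)" for z
    by (simp add: assms(5,6,7,9) gap_operator_def)
  have angle: "a \<bullet> b \<le> ?c * norm a * norm b"
    if "a \<in> off_intersection U V" "b \<in> off_intersection V U" for a b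
    using that inner_le_cos_friedrichs_angle[OF U V assms(3), of a b]
    by (auto simp: assms(4) off_intersection_def)
  note conv = relaxed_projections_converge[OF U V \<gamma> _ c angle \<beta>c \<beta>]
  have "fix_set S = U \<inter> V"
  proof
    show "U \<inter> V \<subseteq> fix_set S"
      using U V by (auto simp: fix_set_def S relaxed_proj_self)
    show "fix_set S \<subseteq> U \<inter> V"
    proof
      fix z assume "z \<in> fix_set S"
      then have z: "z = relaxed_proj \<alpha>\<^sub>1 U (relaxed_proj \<alpha>\<^sub>1 V z)"
        by (simp add: fix_set_def S)
      let ?w = "closest_point (U \<inter> V) z"
      \<comment> \<open>A fixed point is a constant orbit; the convergence result at rate 1 puts it
        within every \<open>\<epsilon>\<close> of its projection onto
        \<open>U \<inter> V\<close>.\<close>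
      have "norm (z - ?w) \<le> 0 + \<epsilon>" if "0 < \<epsilon>" for \<epsilon>
        using conv[of 1 "\<lambda>_. z" \<epsilon>] \<gamma> z that by (auto dest: eventually_happens)
      then have "norm (z - ?w) \<le> 0"
        by (rule field_le_epsilon)
      then have "z = ?w" by simp
      then show "z \<in> U \<inter> V"
        using closest_point_subspace_orthogonal(1)[OF subspace_inter[OF U V]] by metis
    qed
  qed
  moreover have "\<exists>N. \<forall>k\<ge>N. norm (x k - closest_point (U \<inter> V) (x 0)) \<le> \<mu> ^ k * norm (x 0)"
  \<comment> \<open>The norm of \<open>x 0\<close> serves as the positive constant
    \<open>\<epsilon>\<close>; the zero start gives the zero orbit and is treated apart.\<close>
  proof (cases "x 0 = 0")
    case True
    have "0 \<in> U \<inter> V" using U V by (simp add: subspace_0)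
    moreover have "x k = 0" for k
      by (induction k) (use True U V in \<open>auto simp: assms(10) S relaxed_proj_self subspace_0\<close>)
    ultimately show ?thesis by (simp add: closest_point_self)
  next
    case False
    then show ?thesis
      using conv[of \<mu> x "norm (x 0)"] \<mu> assms(10) S
      by (auto simp: eventually_sequentially mult.commute)
  qed
  ultimately show "\<exists>N. \<forall>k\<ge>N. norm (x k - closest_point (fix_set S) (x 0)) \<le> \<mu> ^ k * norm (x 0)"
    by simp
qed

end
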